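(* Let $\mathbb{F}$ be an ordered field and let $\mathcal{L}=\{L_1,L_2,\ldots,L_n\}$ ($n\ge 3$) be a line arrangement in $\mathbb{F}^2$ which gives rise to an $n$-gonality in the anticlockwise cyclic order $L_1\to L_2\to\cdots\to L_n\to L_1$. Then the cycle at infinity of $\mathcal{L}$ has a $2$-standard consecutive structure.
   Context: An ordered field is a totally ordered field with $x\le y\Rightarrow x+z\le y+z$ and $x,y\ge0\Rightarrow xy\ge0$. A line arrangement is a finite set of lines in $\mathbb{F}^2$ with no two parallel and no three concurrent. Regions of the arrangement: if $L_i$ has equation $a_ix+b_iy=c_i$, a region is a set $\{(x,y): \varepsilon_i(a_ix+b_iy-c_i)\ge 0\ \forall i\}$ (some choice of signs $\varepsilon_i$) containing a point where all inequalities are strict; it is bounded if it contains no ray $\{v+tw:t\ge 0\}$ with $w\ne 0$. An $n$-gonality with anticlockwise cyclic order $L_1\to\cdots\to L_n\to L_1$ is a bounded region $R$ such that each $L_i$ meets $R$ in a segment $[v_i,w_i]$ whose endpoints are adjacent intersection points of the arrangement on $L_i$, and the sides $L_1,\ldots,L_n$ occur in this order when the boundary of $R$ is traversed anticlockwise (positively, with respect to the orientation of $\mathbb{F}^2$ given by the quadrant order $I\to II\to III\to IV$). Cycle at infinity: take a line $L$ not through the origin, not parallel to any $L_i$, such that all intersection points $L_i\cap L_j$ lie in the open half-plane of $L$ containing the origin; orient $L$ so that the origin lies on its left; listing the indices of the lines $L_i$ in the order in which the points $L\cap L_i$ occur along the orientation of $L$ gives an $n$-cycle $(i_1i_2\ldots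 i_n)\in S_n$, the cycle at infinity. Writing an $n$-cycle as $(a_1=1,a_2,\ldots,a_n)$, it has a $2$-standard consecutive structure if the minimal number of blocks in a partition of $\{1,\ldots,n\}$ into blocks of consecutive integers $\{c,\ldots,c+r\}$, each occurring in increasing order from left to right in the word $a_1\cdots a_n$, equals $2$. *)

theory Defs
  imports "HOL-Library.Disjoint_Sets" "HOL-Combinatorics.Cycles"
begin

section \<open>Lines in the plane over an ordered field\<close>

definition line :: "'a \<Rightarrow> 'a \<Rightarrow> 'a \<Rightarrow> ('a::linordered_field \<times> 'a) set" where
  "line a b c = {(x, y). a * x + b * y = c}"

definition is_line :: "('a::linordered_field \<times> 'a) set \<Rightarrow> bool" where
  "is_line l \<longleftrightarrow> (\<exists>a b c. (a, b) \<noteq> (0, 0) \<and> l = line a b c)"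

definition parallel :: "'b set \<Rightarrow> 'b set \<Rightarrow> bool" where
  "parallel l m \<longleftrightarrow> l = m \<or> l \<inter> m = {}"

definition line_arrangement :: "('a::linordered_field \<times> 'a) set set \<Rightarrow> bool" where
  "line_arrangement A \<longleftrightarrow>
     finite A \<and> (\<forall>l\<in>A. is_line l) \<and>
     (\<forall>l\<in>A. \<forall>m\<in>A. l \<noteq> m \<longrightarrow> \<not> parallel l m) \<and>
     (\<forall>l\<in>A. \<forall>m\<in>A. \<forall>k\<in>A. l \<noteq> m \<and> l \<noteq> k \<and> m \<noteq> k \<longrightarrow> l \<inter> m \<inter> k = {})"

text \<open>The intersection points of the arrangement lying on \<open>l\<close>.\<close>
definition crossings_on :: "'b set set \<Rightarrow> 'b set \<Rightarrow> 'b set" where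
  "crossings_on A l = (\<Union>m\<in>A - {l}. l \<inter> m)"

definition crossings :: "'b set set \<Rightarrow> 'b set" where
  "crossings A = (\<Union>l\<in>A. crossings_on A l)"

definition segment :: "'a::linordered_field \<times> 'a \<Rightarrow> 'a \<times> 'a \<Rightarrow> ('a \<times> 'a) set" where
  "segment v w =
     {((1 - t) * fst v + t * fst w, (1 - t) * snd v + t * snd w) | t. 0 \<le> t \<and> t \<le> 1}"

definition adjacent_crossings ::
    "('a::linordered_field \<times> 'a) set set \<Rightarrow> ('a \<times> 'a) set \<Rightarrow> 'a \<times> 'a \<Rightarrow> 'a \<times> 'a \<Rightarrow> bool" where
  "adjacent_crossings A l v w \<longleftrightarrow>
     v \<noteq> w \<and> crossings_on A l \<inter> segment v w = {v, w}"

text \<open>Positive iff \<open>z\<close> lies strictly to the left of the line through \<open>u\<close> and \<open>v\<close> oriented from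
  \<open>u\<close> to \<open>v\<close>, i.e. iff \<open>u, v, z\<close> is anticlockwise.\<close>
definition orient :: "'a::linordered_field \<times> 'a \<Rightarrow> 'a \<times> 'a \<Rightarrow> 'a \<times> 'a \<Rightarrow> 'a" where
  "orient u v z = (fst v - fst u) * (snd z - snd u) - (snd v - snd u) * (fst z - fst u)"


section \<open>Regions and polygonalities\<close>

definition region ::
    "('a::linordered_field \<times> 'a) set set \<Rightarrow> ('a \<times> 'a) set \<Rightarrow> bool" where
  "region A R \<longleftrightarrow>
     (\<exists>a b c e. (\<forall>l\<in>A. (a l, b l) \<noteq> (0, 0) \<and> l = line (a l) (b l) (c l) \<and> e l \<in> {1, -1}) \<and>
        R = {(x, y). \<forall>l\<in>A. e l * (a l * x + b l * y - c l) \<ge> 0} \<and>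
        (\<exists>x y. \<forall>l\<in>A. e l * (a l * x + b l * y - c l) > 0))"

definition bounded_region :: "('a::linordered_field \<times> 'a) set \<Rightarrow> bool" where
  "bounded_region R \<longleftrightarrow>
     \<not> (\<exists>v w. w \<noteq> (0, 0) \<and> {(fst v + t * fst w, snd v + t * snd w) | t. t \<ge> 0} \<subseteq> R)"

text \<open>The lines are indexed by \<open>{1..n}\<close>; \<open>i mod n + 1\<close> is the cyclic successor of \<open>i\<close>. The sides
  occur in the order \<open>1, \<dots>, n\<close> along the boundary: the \<open>i\<close>-th side, traversed from \<open>v i\<close> to
  \<open>w i\<close>, ends where the next one starts. The traversal is anticlockwise: \<open>R\<close> lies on the left
  of every side.\<close>
definition gonality :: "nat \<Rightarrow> (nat \<Rightarrow> ('a::linordered_field \<times> 'a) set) \<Rightarrow> bool" where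
  "gonality n L \<longleftrightarrow>
     (\<exists>R v w. region (L ` {1..n}) R \<and> bounded_region R \<and>
        (\<forall>i\<in>{1..n}. L i \<inter> R = segment (v i) (w i) \<and>
                    adjacent_crossings (L ` {1..n}) (L i) (v i) (w i) \<and>
                    w i = v (i mod n + 1) \<and>
                    (\<forall>z\<in>R. orient (v i) (w i) z \<ge> 0)))"


section \<open>The cycle at infinity\<close>

text \<open>A line avoiding the origin has an equation \<open>p x + q y = r\<close> with \<open>r > 0\<close>, and then
  \<open>p x + q y < r\<close> describes its open side containing the origin.\<close>
definition line_at_infinity ::
    "('a::linordered_field \<times> 'a) set set \<Rightarrow> ('a \<times> 'a) set \<Rightarrow> bool" where
  "line_at_infinity A M \<longleftrightarrow>
     (\<forall>l\<in>A. \<not> parallel M l) \<and>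
     (\<exists>p q r. (p, q) \<noteq> (0, 0) \<and> r > 0 \<and> M = line p q r \<and>
        (\<forall>(x, y)\<in>crossings A. p * x + q * y < r))"

text \<open>A point \<open>P\<close> precedes \<open>Q\<close> on \<open>M\<close>, oriented with the origin on its left, iff the origin is
  to the left of the direction from \<open>P\<close> to \<open>Q\<close>.\<close>
definition is_cycle_at_infinity ::
    "nat \<Rightarrow> (nat \<Rightarrow> ('a::linordered_field \<times> 'a) set) \<Rightarrow> (nat \<Rightarrow> nat) \<Rightarrow> bool" where
  "is_cycle_at_infinity n L \<sigma> \<longleftrightarrow>
     (\<exists>M xs. line_at_infinity (L ` {1..n}) M \<and> distinct xs \<and> set xs = {1..n} \<and>
        sorted_wrt (\<lambda>i j. orient (the_elem (M \<inter> L i)) (the_elem (M \<inter> L j)) (0, 0) > 0) xs \<and>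
        \<sigma> = cycle_of_list xs)"

text \<open>Every arrangement has a cycle at infinity: take \<open>x + t y = r\<close> with \<open>t\<close> avoiding the
  finitely many normal directions and \<open>r\<close> large.\<close>
lemma ex_cycle_at_infinity:
  fixes L :: "nat \<Rightarrow> ('a::linordered_field \<times> 'a) set"
  assumes inj: "inj_on L {1..n}" and arr: "line_arrangement (L ` {1..n})"
  shows "\<exists>\<sigma>. is_cycle_at_infinity n L \<sigma>"
proof -
  have "\<forall>i\<in>{1..n}. \<exists>a b c. (a, b) \<noteq> (0, 0) \<and> L i = line a b c"
    using arr by (auto simp: line_arrangement_def is_line_def)
  then obtain a b c where
    ne: "\<And>i. i \<in> {1..n} \<Longrightarrow> (a i, b i) \<noteq> (0, 0)" and
    eq: "\<And>i. i \<in> {1..n} \<Longrightarrow> L i = line (a i) (b i) (c i)"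
    by metis
  have "finite ((\<lambda>i. b i / a i) ` {1..n})" by simp
  then obtain t where t: "t \<notin> (\<lambda>i. b i / a i) ` {1..n}"
    using ex_new_if_finite[OF infinite_UNIV_char_0] by blast
  define d where "d i = a i * t - b i" for i
  have d: "d i \<noteq> 0" if "i \<in> {1..n}" for i
  proof
    assume "d i = 0"
    then have *: "b i = a i * t" by (simp add: d_def)
    with ne[OF that] have "a i \<noteq> 0" by auto
    with * have "t = b i / a i" by (simp add: field_simps)
    with t that show False by blast
  qed
  have fin: "finite (crossings (L ` {1..n}))"
  proof -
    have "finite (l \<inter> m)" if lm: "l \<in> L ` {1..n}" "m \<in> L ` {1..n}" "l \<noteq> m" for l m
    proof -
      from lm obtain i j where ij: "i \<in> {1..n}" "j \<in> {1..n}" "l = L i" "m = L j" by (metis imageE)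
      have "u = w" if uw: "u \<in> l \<inter> m" "w \<in> l \<inter> m" for u w
      proof -
        obtain u1 u2 w1 w2 where u: "u = (u1, u2)" "w = (w1, w2)" by (cases u, cases w)
        have e: "a i * u1 + b i * u2 = c i" "a i * w1 + b i * w2 = c i"
             "a j * u1 + b j * u2 = c j" "a j * w1 + b j * w2 = c j"
          using uw u ij eq by (auto simp: line_def)
        define D where "D = a i * b j - a j * b i"
        have "D * (u1 - w1) = b j * ((a i * u1 + b i * u2) - (a i * w1 + b i * w2))
            - b i * ((a j * u1 + b j * u2) - (a j * w1 + b j * w2))"
          by (simp add: D_def algebra_simps)
        then have "D * (u1 - w1) = 0" by (simp add: e)
        moreover
        have "D * (u2 - w2) = a i * ((a j * u1 + b j * u2) - (a j * w1 + b j * w2))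
            - a j * ((a i * u1 + b i * u2) - (a i * w1 + b i * w2))"
          by (simp add: D_def algebra_simps)
        then have "D * (u2 - w2) = 0" by (simp add: e)
        moreover have "D \<noteq> 0"
        proof
          assume D0: "D = 0"
          have "(x, y) \<in> L i \<longleftrightarrow> (x, y) \<in> L j" for x y
          proof -
            have "a i * (a j * x + b j * y - c j) - a j * (a i * x + b i * y - c i) = D * (y - u2)"
              unfolding e(1,3)[symmetric] D_def by (simp add: algebra_simps)
            moreover
            have "b i * (a j * x + b j * y - c j) - b j * (a i * x + b i * y - c i) = D * (u1 - x)"
              unfolding e(1,3)[symmetric] D_def by (simp add: algebra_simps)
            ultimately
            have "a j * x + b j * y - c j = 0 \<longleftrightarrow> a i * x + b i * y - c i = 0"
              using ne[OF ij(1)] ne[OF ij(2)] D0 by auto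
            then show ?thesis using ij eq by (auto simp: line_def)
          qed
          then have "L i = L j" by auto
          with ij lm show False by simp
        qed
        ultimately show ?thesis using u by simp
      qed
      then show ?thesis by (metis finite.simps finite_subset insertI1 subsetI)
    qed
    then show ?thesis unfolding crossings_def crossings_on_def
      by (intro finite_UN_I) auto
  qed
  define F where "F = insert 0 ((\<lambda>(x, y). x + t * y) ` crossings (L ` {1..n}))"
  define r where "r = Max F + 1"
  have finF: "finite F" using fin by (simp add: F_def)
  have r: "z < r" if "z \<in> F" for z
    using Max_ge[OF finF that] unfolding r_def by (simp add: add_strict_increasing2 less_add_one order_le_less_trans)
  have r0: "r > 0" using r[of 0] by (simp add: F_def)
  define M where "M = line 1 t r"
  define f where "f i = (a i * r - c i) / d i" for i
  have pt: "M \<inter> L i = {(r - t * f i, f i)}" if i: "i \<in> {1..n}" for i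
  proof -
    have "(x, y) \<in> M \<inter> L i \<longleftrightarrow> x = r - t * y \<and> y = f i" for x y
    proof -
      have "(x, y) \<in> M \<inter> L i \<longleftrightarrow> x = r - t * y \<and> a i * (r - t * y) + b i * y = c i"
        using eq[OF i] by (auto simp: M_def line_def algebra_simps)
      also have "a i * (r - t * y) + b i * y = c i \<longleftrightarrow> y * d i = a i * r - c i"
        by (auto simp: d_def algebra_simps)
      also have "\<dots> \<longleftrightarrow> y = f i" using d[OF i] by (auto simp: f_def field_simps)
      finally show ?thesis .
    qed
    then show ?thesis by (auto simp only: set_eq_iff split_paired_All singleton_iff prod.inject)
  qed
  have cr: "x + t * y < r" if "(x, y) \<in> crossings (L ` {1..n})" for x y
    using that by (intro r) (force simp: F_def)
  have adm: "line_at_infinity (L ` {1..n}) M"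
  proof -
    have "\<not> parallel M (L i)" if i: "i \<in> {1..n}" for i
    proof
      assume p: "parallel M (L i)"
      have s: "M = {(r - t * f i, f i)}" using p pt[OF i] by (auto simp: parallel_def)
      have "(r - t * (f i + 1), f i + 1) \<in> M" by (simp add: M_def line_def)
      with s show False by simp
    qed
    moreover have "\<exists>p q r. (p, q) \<noteq> (0, 0) \<and> r > 0 \<and> M = line p q r \<and>
        (\<forall>(x, y)\<in>crossings (L ` {1..n}). p * x + q * y < r)"
      by (rule exI[of _ 1], rule exI[of _ t], rule exI[of _ r]) (use cr r0 in \<open>auto simp: M_def\<close>)
    ultimately show ?thesis by (auto simp: line_at_infinity_def)
  qed
  have injf: "inj_on f {1..n}"
  proof (rule inj_onI, rule ccontr)
    fix i j assume ij: "i \<in> {1..n}" "j \<in> {1..n}" "f i = f j" "i \<noteq> j"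
    let ?P = "(r - t * f i, f i)"
    have "?P \<in> L i \<inter> L j" using pt[OF ij(1)] pt[OF ij(2)] ij(3) by auto
    moreover have "L i \<noteq> L j" using inj_onD[OF inj] ij by blast
    ultimately have "?P \<in> crossings (L ` {1..n})"
      using ij(1,2) unfolding crossings_def crossings_on_def by blast
    from cr[OF this] show False by simp
  qed
  define xs where "xs = sort_key f [1..<Suc n]"
  have xs: "distinct xs" "set xs = {1..n}" "sorted (map f xs)"
    by (auto simp: xs_def)
  have "distinct (map f xs)" using xs injf by (simp add: distinct_map)
  with xs(3) have "sorted_wrt (<) (map f xs)" by (simp add: strict_sorted_iff)
  then have "sorted_wrt (\<lambda>i j. f i < f j) xs" by (simp add: sorted_wrt_map)
  then have "sorted_wrt (\<lambda>i j. orient (the_elem (M \<inter> L i)) (the_elem (M \<inter> L j)) (0, 0) > 0) xs"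
  proof (rule sorted_wrt_mono_rel[rotated])
    fix i j assume "i \<in> set xs" "j \<in> set xs" "f i < f j"
    then have "orient (the_elem (M \<inter> L i)) (the_elem (M \<inter> L j)) (0, 0) = r * (f j - f i)"
      using pt xs(2) by (simp add: orient_def algebra_simps)
    then show "orient (the_elem (M \<inter> L i)) (the_elem (M \<inter> L j)) (0, 0) > 0"
      using r0 \<open>f i < f j\<close> by simp
  qed
  with adm xs show ?thesis unfolding is_cycle_at_infinity_def by blast
qed


section \<open>Standard consecutive structures\<close>

definition consecutive_partition :: "nat list \<Rightarrow> nat set set \<Rightarrow> bool" where
  "consecutive_partition as P \<longleftrightarrow>
     partition_on (set as) P \<and>
     (\<forall>B\<in>P. (\<exists>c r. B = {c..c + r}) \<and> sorted (filter (\<lambda>a. a \<in> B) as))"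

definition standard_consecutive_structure :: "nat \<Rightarrow> (nat \<Rightarrow> nat) \<Rightarrow> nat \<Rightarrow> bool" where
  "standard_consecutive_structure n \<sigma> k \<longleftrightarrow>
     (\<exists>as. distinct as \<and> set as = {1..n} \<and> hd as = 1 \<and> \<sigma> = cycle_of_list as \<and>
        (\<exists>P. consecutive_partition as P \<and> card P = k) \<and>
        (\<forall>P. consecutive_partition as P \<longrightarrow> k \<le> card P))"

end

theory Submission
  imports Defs "HOL-Library.Product_Plus"
begin

text \<open>Let \<open>d\<^sub>i\<close> be the direction of the \<open>i\<close>-th side and \<open>\<theta>\<^sub>i\<close> its angle measured from \<open>d\<^sub>1\<close>. Along the
  boundary of the convex polygon \<open>\<theta>\<close> increases from \<open>0\<close> to less than \<open>2\<pi>\<close>, whereas the cycle at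
  infinity, read from \<open>1\<close>, lists the lines by increasing \<open>\<theta>\<^sub>i\<close> modulo \<open>\<pi>\<close>. The two blocks are
  therefore \<open>\<theta>\<^sub>i < \<pi>\<close> and \<open>\<theta>\<^sub>i > \<pi>\<close>; one block does not suffice, because the angle between two
  successive sides is less than \<open>\<pi>\<close>, so that the first side of the second block precedes the last
  side of the first one. Angles are replaced by signs of cross products.\<close>

section \<open>Cross products\<close>

definition cross :: "'a::comm_ring \<times> 'a \<Rightarrow> 'a \<times> 'a \<Rightarrow> 'a" where
  "cross u v = fst u * snd v - snd u * fst v"

lemma cross_self [simp]: "cross u u = 0"
  by (simp add: cross_def mult.commute)

lemma cross_diff_left: "cross (u - v) w = cross u w - cross v w"
  by (simp add: cross_def algebra_simps)

lemma cross_diff_right: "cross w (u - v) = cross w u - cross w v"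
  by (simp add: cross_def algebra_simps)

lemma cross_anticommute: "cross u v = - cross v u"
  by (simp add: cross_def algebra_simps)

text \<open>The three-term Pluecker relation. With \<open>s\<close> as reference direction it adds
  positive turns: from \<open>t\<close> to \<open>u\<close> and from \<open>u\<close> to
  \<open>v\<close> gives from \<open>t\<close> to \<open>v\<close>, provided all three lie strictly
  on the same side of \<open>s\<close>.\<close>

lemma cross_pluecker: "cross s u * cross t v = cross s t * cross u v + cross s v * cross t u"
  by (simp add: cross_def algebra_simps)

lemma orient_cross: "orient u v z = cross (v - u) (z - u)"
  by (simp add: orient_def cross_def)

lemma orient_cross': "orient u v z = cross (v - u) (z - v)"
  by (simp add: orient_def cross_def algebra_simps)

lemma cross_eq_0_both:
  fixes f g y :: "'a::field \<times> 'a"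
  assumes "cross f y = 0" "cross g y = 0" "cross f g \<noteq> 0"
  shows "y = 0"
proof -
  \<comment> \<open>Cramer's rule.\<close>
  have "cross f g * fst y = fst g * cross f y - fst f * cross g y"
       "cross f g * snd y = snd g * cross f y - snd f * cross g y"
    by (simp_all add: cross_def algebra_simps)
  then have "fst y = 0" "snd y = 0" using assms by simp_all
  then show ?thesis by (simp add: prod_eq_iff)
qed

text \<open>If the direction \<open>f\<close> of a side points towards the line with direction \<open>e\<close> and the direction
  \<open>g\<close> of the next side away from it, then their common vertex is the unique point of the polygon
  closest to that line; \<open>y\<close> is the position of another point of the polygon relative to it.\<close>
lemma cross_local_min:
  fixes e f g y :: "'a::linordered_field \<times> 'a"
  assumes "cross e f < 0" "cross e g > 0" "cross f g > 0"
    and "cross f y \<ge> 0" "cross g y \<ge> 0" "cross e y \<le> 0"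
  shows "y = 0"
proof -
  \<comment> \<open>Up to the factor \<open>cross f g\<close>, \<open>e\<close> is a combination of
    \<open>f\<close> and \<open>g\<close> with positive coefficients. A nonpositive left side thus
    equals a sum of nonnegative terms, and both terms vanish.\<close>
  have eq: "cross f g * cross e y = cross e g * cross f y + (- cross e f) * cross g y"
    by (simp add: cross_def algebra_simps)
  have "cross e g * cross f y \<ge> 0" "(- cross e f) * cross g y \<ge> 0" "cross f g * cross e y \<le> 0"
    using assms by (simp_all add: mult_nonneg_nonpos mult_nonpos_nonneg mult_nonpos_nonpos)
  then have "cross e g * cross f y = 0" "(- cross e f) * cross g y = 0"
    using eq by linarith+
  then have "cross f y = 0" "cross g y = 0" using assms by auto
  then show ?thesis using assms(3) cross_eq_0_both[of f y g] by simp
qed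

section \<open>Lines\<close>

lemma is_line_points:
  assumes l: "is_line l" and u: "u \<in> l" and w: "w \<in> l" and "u \<noteq> w" and x: "x \<in> l" and y: "y \<in> l"
  obtains t where "fst (y - x) = t * fst (w - u)" "snd (y - x) = t * snd (w - u)"
proof -
  obtain a b c where ab: "(a, b) \<noteq> (0, 0)" and l_eq: "l = line a b c"
    using l by (auto simp: is_line_def)
  define d e where "d = w - u" and "e = y - x"
  have d: "a * fst d + b * snd d = 0" and e: "a * fst e + b * snd e = 0"
    using u w x y by (auto simp: l_eq line_def d_def e_def algebra_simps)
  have "cross d e = 0"
  proof -
    \<comment> \<open>Both differences are orthogonal to the nonzero normal \<open>(a, b)\<close>,
      hence dependent.\<close>
    have "a * cross d e = snd e * (a * fst d + b * snd d) - snd d * (a * fst e + b * snd e)"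
         "b * cross d e = fst d * (a * fst e + b * snd e) - fst e * (a * fst d + b * snd d)"
      by (simp_all add: cross_def algebra_simps)
    then show ?thesis using ab d e by auto
  qed
  then have c: "fst d * snd e = snd d * fst e" by (simp add: cross_def)
  have "d \<noteq> 0" using \<open>u \<noteq> w\<close> by (simp add: d_def)
  then consider "fst d \<noteq> 0" | "snd d \<noteq> 0" by (auto simp: prod_eq_iff)
  then have "\<exists>t. fst e = t * fst d \<and> snd e = t * snd d"
  proof cases
    case 1
    then show ?thesis by (intro exI[of _ "fst e / fst d"]) (use c in \<open>simp add: field_simps\<close>)
  next
    case 2
    then show ?thesis by (intro exI[of _ "snd e / snd d"]) (use c in \<open>simp add: field_simps\<close>)
  qed
  then show ?thesis unfolding d_def e_def by (elim exE conjE) (rule that)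
qed

lemma line_subset_if_cross_0:
  assumes l: "is_line l" "u \<in> l" "w \<in> l" "u \<noteq> w" and m: "is_line m" "u' \<in> m" "w' \<in> m" "u' \<noteq> w'"
    and cr: "cross (w - u) (w' - u') = 0" and z: "z \<in> l" "z \<in> m"
  shows "l \<subseteq> m"
proof
  fix x assume "x \<in> l"
  then obtain t where t: "fst (x - z) = t * fst (w - u)" "snd (x - z) = t * snd (w - u)"
    by (rule is_line_points[OF l z(1)]) (rule that)
  obtain a b c where m_eq: "m = line a b c"
    using m(1) by (auto simp: is_line_def)
  define d e where "d = w - u" and "e = w' - u'"
  have e: "a * fst e + b * snd e = 0"
    using m(2,3) by (auto simp: m_eq line_def e_def algebra_simps)
  have c: "fst d * snd e = snd d * fst e" using cr by (simp add: cross_def d_def e_def)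
  have "fst e * (a * fst d + b * snd d) = fst d * (a * fst e + b * snd e)"
       "snd e * (a * fst d + b * snd d) = snd d * (a * fst e + b * snd e)"
    using c by (simp_all add: algebra_simps)
  moreover have "fst e \<noteq> 0 \<or> snd e \<noteq> 0" using m(4) by (auto simp: e_def prod_eq_iff)
  ultimately have d: "a * fst d + b * snd d = 0" using e by auto
  have "a * fst x + b * snd x = a * fst z + b * snd z + (a * fst (x - z) + b * snd (x - z))"
    by (simp add: algebra_simps)
  also have "a * fst (x - z) + b * snd (x - z) = t * (a * fst d + b * snd d)"
    unfolding t d_def by (simp add: algebra_simps)
  finally show "x \<in> m" using z(2) d by (simp add: m_eq line_def case_prod_beta)
qed

text \<open>Since \<open>parallel\<close> means equal or disjoint, non-parallel lines share a point;
  proportional directions through it would make the lines equal.\<close>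

lemma cross_nonzero_if_not_parallel:
  assumes l: "is_line l" "u \<in> l" "w \<in> l" "u \<noteq> w" and m: "is_line m" "u' \<in> m" "w' \<in> m" "u' \<noteq> w'"
    and np: "\<not> parallel l m"
  shows "cross (w - u) (w' - u') \<noteq> 0"
proof
  assume c: "cross (w - u) (w' - u') = 0"
  then have c': "cross (w' - u') (w - u) = 0" using cross_anticommute[of "w' - u'" "w - u"] by simp
  from np obtain z where z: "z \<in> l" "z \<in> m" by (auto simp: parallel_def)
  have "l \<subseteq> m" by (rule line_subset_if_cross_0[OF l m c z])
  moreover have "m \<subseteq> l" by (rule line_subset_if_cross_0[OF m l c' z(2,1)])
  ultimately show False using np by (simp add: parallel_def)
qed

lemma lines_meet_in_point:
  assumes "is_line l" "is_line m" "\<not> parallel l m"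
  obtains z where "l \<inter> m = {z}"
proof -
  from assms(3) obtain z where z: "z \<in> l" "z \<in> m" by (auto simp: parallel_def)
  have "x = z" if "x \<in> l" "x \<in> m" for x
  proof (rule ccontr)
    assume "x \<noteq> z"
    with assms z that have "cross (z - x) (z - x) \<noteq> 0"
      by (intro cross_nonzero_if_not_parallel)
    then show False by simp
  qed
  with z have "l \<inter> m = {z}" by blast
  then show ?thesis by (rule that)
qed

text \<open>The crossing point \<open>x\<close> lies on the inner side of the line at infinity with normal \<open>(p, q)\<close>,
  so the order of \<open>y\<close> and \<open>z\<close> on the latter is determined by the directions of \<open>l\<close> and \<open>m\<close>.\<close>
lemma cross_of_order_at_infinity:
  assumes l: "is_line l" "u \<in> l" "w \<in> l" "u \<noteq> w" and m: "is_line m" "u' \<in> m" "w' \<in> m" "u' \<noteq> w'"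
    and x: "x \<in> l" "x \<in> m" "p * fst x + q * snd x < r" and "r > 0"
    and y: "y \<in> line p q r" "y \<in> l" and z: "z \<in> line p q r" "z \<in> m"
    and yz: "orient y z (0, 0) > 0"
  shows "cross (w - u) (w' - u') * (cross (w - u) (- q, p) * cross (w' - u') (- q, p)) > 0"
proof -
  \<comment> \<open>The direction of the line at infinity; pairing with it evaluates the linear form
    \<open>p * x + q * y\<close>.\<close>
  define N where "N = (- q, p)"
  obtain s where s: "fst (y - x) = s * fst (w - u)" "snd (y - x) = s * snd (w - u)"
    by (rule is_line_points[OF l x(1) y(2)]) (rule that)
  obtain t where t: "fst (z - x) = t * fst (w' - u')" "snd (z - x) = t * snd (w' - u')"
    by (rule is_line_points[OF m x(2) z(2)]) (rule that)
  have N: "cross v N = p * fst v + q * snd v" for v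
    by (simp add: N_def cross_def algebra_simps)
  have yN: "cross y N = r" and zN: "cross z N = r"
    using y z by (simp_all add: N line_def case_prod_beta)
  have xN: "cross x N < r" using x by (simp add: N)
  \<comment> \<open>In the Pluecker relation for \<open>y - x\<close>, \<open>z - y\<close>,
    \<open>y\<close>, \<open>N\<close> one term drops out, because \<open>z - y\<close> runs along
    the line at infinity.\<close>
  have "r * cross (y - x) (z - y) = cross (y - x) N * cross y (z - y)"
    using cross_pluecker[of "y - x" "z - y" y N] cross_pluecker[of "y - x" N y "z - y"]
      yN zN cross_anticommute[of N "z - y"]
    by (simp add: cross_diff_left mult.commute)
  moreover have "cross y (z - y) > 0" using yz by (simp add: orient_def cross_def algebra_simps)
  ultimately have "r * cross (y - x) (z - y) > 0"
    using xN yN by (simp add: cross_diff_left)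
  then have "cross (y - x) (z - y) > 0" using \<open>r > 0\<close> by (simp add: zero_less_mult_iff)
  then have "cross (y - x) (z - x) > 0" by (simp add: cross_def algebra_simps)
  moreover have "cross (y - x) (z - x) = s * t * cross (w - u) (w' - u')"
    unfolding cross_def s t by (simp add: algebra_simps)
  ultimately have st: "s * t * cross (w - u) (w' - u') > 0" by (simp only:)
  have "cross (y - x) N = s * cross (w - u) N" "cross (z - x) N = t * cross (w' - u') N"
    unfolding cross_def s t by (simp_all add: algebra_simps)
  moreover have "cross (y - x) N > 0" "cross (z - x) N > 0"
    using xN yN zN by (simp_all add: cross_diff_left)
  ultimately have "s * cross (w - u) N > 0" "t * cross (w' - u') N > 0" by (simp_all only:)
  \<comment> \<open>The parameters \<open>s\<close> and \<open>t\<close> may have either sign; in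
    the product of the three positive quantities they only occur as the square of
    \<open>s * t\<close>.\<close>
  with st have "(s * t * cross (w - u) (w' - u')) *
      ((s * cross (w - u) N) * (t * cross (w' - u') N)) > 0"
    by (rule mult_pos_pos[OF _ mult_pos_pos])
  also have "(s * t * cross (w - u) (w' - u')) * ((s * cross (w - u) N) * (t * cross (w' - u') N)) =
      (s * t)\<^sup>2 * (cross (w - u) (w' - u') * (cross (w - u) N * cross (w' - u') N))"
    by (simp add: power2_eq_square)
  finally show ?thesis
    unfolding N_def by (meson mult_nonneg_nonpos not_less zero_le_power2)
qed

section \<open>Side directions of an $n$-gonality\<close>

text \<open>Once the boundary descends towards \<open>L 1\<close> it cannot rise again before
  closing up: the turning vertex would be the only point of \<open>R\<close> closest to
  \<open>L 1\<close>, whereas a whole side of \<open>R\<close> lies on \<open>L 1\<close>. So the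
  sign relative to the first side changes once, after \<open>j\<close>.\<close>

lemma gonality_directions:
  fixes L :: "nat \<Rightarrow> ('a::linordered_field \<times> 'a) set"
  assumes n: "n \<ge> 3" and inj: "inj_on L {1..n}" and arr: "line_arrangement (L ` {1..n})"
    and gon: "gonality n L"
  obtains v w j where
    "\<And>i. i \<in> {1..n} \<Longrightarrow> v i \<in> L i \<and> w i \<in> L i \<and> v i \<noteq> w i"
    "2 \<le> j" "j < n"
    "\<And>i. 2 \<le> i \<Longrightarrow> i \<le> j \<Longrightarrow> cross (w 1 - v 1) (w i - v i) > 0"
    "\<And>i. j < i \<Longrightarrow> i \<le> n \<Longrightarrow> cross (w 1 - v 1) (w i - v i) < 0"
    "\<And>i. 1 \<le> i \<Longrightarrow> i < n \<Longrightarrow> cross (w i - v i) (w (Suc i) - v (Suc i)) > 0"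
proof -
  obtain R v w where sides: "\<forall>i\<in>{1..n}. L i \<inter> R = segment (v i) (w i) \<and>
      adjacent_crossings (L ` {1..n}) (L i) (v i) (w i) \<and> w i = v (i mod n + 1) \<and>
      (\<forall>z\<in>R. orient (v i) (w i) z \<ge> 0)"
    using gon unfolding gonality_def by (elim exE conjE) (rule that)
  have seg: "L i \<inter> R = segment (v i) (w i)"
    and adj: "adjacent_crossings (L ` {1..n}) (L i) (v i) (w i)"
    and succ: "w i = v (i mod n + 1)"
    and left: "z \<in> R \<Longrightarrow> orient (v i) (w i) z \<ge> 0" if "i \<in> {1..n}" for i z
    using sides that by blast+
  define d where "d i = w i - v i" for i
  have "v i \<in> segment (v i) (w i)" for i
    unfolding segment_def by (auto intro!: exI[of _ 0] simp: prod_eq_iff)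
  moreover have "w i \<in> segment (v i) (w i)" for i
    unfolding segment_def by (auto intro!: exI[of _ 1] simp: prod_eq_iff)
  ultimately have mem: "v i \<in> L i" "v i \<in> R" "w i \<in> L i" "w i \<in> R" if "i \<in> {1..n}" for i
    using seg[OF that] by blast+
  have ne: "v i \<noteq> w i" if "i \<in> {1..n}" for i
    using adj[OF that] by (simp add: adjacent_crossings_def)
  have nonzero: "cross (d i) (d k) \<noteq> 0" if i: "i \<in> {1..n}" and k: "k \<in> {1..n}" and "i \<noteq> k" for i k
    unfolding d_def
  proof (rule cross_nonzero_if_not_parallel)
    have "L i \<noteq> L k" using inj i k \<open>i \<noteq> k\<close> by (simp add: inj_on_eq_iff)
    then show "is_line (L i)" "is_line (L k)" "\<not> parallel (L i) (L k)"
      using arr i k by (auto simp: line_arrangement_def)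
  qed (use mem ne i k in blast)+
  have next_pos: "cross (d i) (d k) > 0"
    if i: "i \<in> {1..n}" and k: "k = i mod n + 1" and "i \<noteq> k" for i k
  proof -
    have kn: "k \<in> {1..n}" using k n by (simp add: Suc_le_eq)
    \<comment> \<open>The next side starts at \<open>w i\<close>, so the position of its end
      \<open>w k\<close> relative to \<open>w i\<close> is \<open>d k\<close>.\<close>
    have "orient (v i) (w i) (w k) \<ge> 0" using left[OF i mem(4)[OF kn]] .
    then have "cross (d i) (d k) \<ge> 0"
      using succ[OF i] k by (simp add: orient_cross' d_def)
    moreover have "cross (d i) (d k) \<noteq> 0"
      by (rule nonzero) (use i kn \<open>i \<noteq> k\<close> in auto)
    ultimately show ?thesis by simp
  qed
  have step: "cross (d i) (d (Suc i)) > 0" if "1 \<le> i" "i < n" for i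
    using next_pos[of i "Suc i"] that by simp
  \<comment> \<open>The successor of \<open>n\<close> is 1, so this is the closing turn with its
    arguments exchanged.\<close>
  have last: "cross (d 1) (d n) < 0"
    using next_pos[of n 1] n cross_anticommute[of "d 1" "d n"] by simp
  have stay: "cross (d 1) (d (Suc i)) < 0" if i: "2 \<le> i" "i < n" and neg: "cross (d 1) (d i) < 0" for i
  proof (rule ccontr)
    assume "\<not> ?thesis"
    moreover have "cross (d 1) (d (Suc i)) \<noteq> 0"
      by (rule nonzero) (use i in auto)
    ultimately have pos: "cross (d 1) (d (Suc i)) > 0" by simp
    have wi: "w i = v (Suc i)" using succ[of i] i by simp
    have i': "1 \<in> {1..n}" "i \<in> {1..n}" "Suc i \<in> {1..n}" using i by auto
    \<comment> \<open>Every point of \<open>R\<close> on \<open>L 1\<close> would be the vertex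
      \<open>w i\<close>; the two distinct ends of the first side are such points.\<close>
    have "z - w i = 0" if z: "z \<in> R" "cross (d 1) (z - v 1) = 0" for z
    proof (rule cross_local_min[OF neg pos step])
      show "cross (d i) (z - w i) \<ge> 0"
        using left[OF i'(2) z(1)] by (simp add: orient_cross' d_def)
      show "cross (d (Suc i)) (z - w i) \<ge> 0"
        using left[OF i'(3) z(1)] by (simp add: orient_cross d_def wi)
      have "cross (d 1) (w i - v 1) \<ge> 0"
        using left[OF i'(1) mem(4)[OF i'(2)]] by (simp add: orient_cross d_def)
      then show "cross (d 1) (z - w i) \<le> 0" using z(2) by (simp add: cross_diff_right)
    qed (use i in auto)
    from this[of "v 1"] this[of "w 1"] have "v 1 = w i" "w 1 = w i"
      using mem[OF i'(1)] by (auto simp: d_def cross_def)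
    then show False using ne[OF i'(1)] by simp
  qed
  \<comment> \<open>\<open>Suc j\<close> is the first descending side; \<open>last\<close> provides
    the candidate \<open>n - 1\<close> for \<open>j\<close>.\<close>
  define j where "j = (LEAST j. cross (d 1) (d (Suc j)) < 0 \<and> 2 \<le> Suc j)"
  have nj: "cross (d 1) (d (Suc (n - 1))) < 0 \<and> 2 \<le> Suc (n - 1)" using last n by simp
  have j: "cross (d 1) (d (Suc j)) < 0" "2 \<le> Suc j"
    using LeastI[of "\<lambda>j. cross (d 1) (d (Suc j)) < 0 \<and> 2 \<le> Suc j", OF nj]
    by (simp_all add: j_def)
  have "j \<le> n - 1" using Least_le[of "\<lambda>j. cross (d 1) (d (Suc j)) < 0 \<and> 2 \<le> Suc j", OF nj]
    by (simp add: j_def)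
  then have "j < n" using n by simp
  have "j \<noteq> 1" using step[of 1] j(1) n by (auto simp: numeral_2_eq_2)
  then have "2 \<le> j" using j(2) by simp
  have up: "cross (d 1) (d i) > 0" if i: "2 \<le> i" "i \<le> j" for i
  proof -
    have "\<not> (cross (d 1) (d (Suc (i - 1))) < 0 \<and> 2 \<le> Suc (i - 1))"
      using not_less_Least[of "i - 1" "\<lambda>j. cross (d 1) (d (Suc j)) < 0 \<and> 2 \<le> Suc j"] i
      by (simp add: j_def)
    then have "cross (d 1) (d i) \<ge> 0" using i by simp
    moreover have "cross (d 1) (d i) \<noteq> 0"
      by (rule nonzero) (use i \<open>j < n\<close> in auto)
    ultimately show ?thesis by simp
  qed
  have down: "cross (d 1) (d i) < 0" if "j < i" "i \<le> n" for i
  proof -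
    have "Suc j \<le> i" using that by simp
    then show ?thesis using \<open>i \<le> n\<close>
    proof (induction i rule: dec_induct)
      case base
      show ?case by (rule j(1))
    next
      case (step k)
      then show ?case using stay[of k] \<open>2 \<le> j\<close> by simp
    qed
  qed
  show ?thesis
    by (rule that[of v w j]) (use mem ne \<open>2 \<le> j\<close> \<open>j < n\<close> up down step in \<open>auto simp: d_def\<close>)
qed

section \<open>Standard consecutive structures\<close>

text \<open>Cutting after \<open>j\<close> gives the upper bound. A single block would be all of
  \<open>{1..n}\<close> and force \<open>as\<close> to be sorted, which gives the lower
  bound.\<close>

lemma standard_consecutive_structure_2I:
  assumes as: "distinct as" "set as = {1..n}" "hd as = 1" and \<sigma>: "\<sigma> = cycle_of_list as"
    and j: "1 \<le> j" "j < n"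
    and low: "sorted (filter (\<lambda>a. a \<le> j) as)" and high: "sorted (filter (\<lambda>a. j < a) as)"
    and unsorted: "\<not> sorted as"
  shows "standard_consecutive_structure n \<sigma> 2"
proof -
  let ?P = "{{1..j}, {Suc j..n}}"
  have "consecutive_partition as ?P"
    unfolding consecutive_partition_def
  proof (intro conjI ballI)
    have "disjoint ?P"
      unfolding disjoint_def by simp
    moreover have "\<Union> ?P = {1..n}" using j by auto
    moreover have "{} \<notin> ?P" using j by simp
    ultimately show "partition_on (set as) ?P"
      unfolding as(2) by (simp only: partition_on_def simp_thms)
  next
    fix B assume "B \<in> ?P"
    then have "B = {1..1 + (j - 1)} \<or> B = {Suc j..Suc j + (n - Suc j)}" using j by simp
    then show "\<exists>c r. B = {c..c + r}" by metis
  next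
    fix B assume "B \<in> ?P"
    moreover have "filter (\<lambda>a. a \<in> {1..j}) as = filter (\<lambda>a. a \<le> j) as"
      "filter (\<lambda>a. a \<in> {Suc j..n}) as = filter (\<lambda>a. j < a) as"
      using as(2) by (auto intro!: filter_cong)
    ultimately show "sorted (filter (\<lambda>a. a \<in> B) as)" using low high by auto
  qed
  moreover have "card ?P = 2"
  proof -
    have "1 \<in> {1..j}" "1 \<notin> {Suc j..n}" using j by auto
    then have "{1..j} \<noteq> {Suc j..n}" by metis
    then show ?thesis by simp
  qed
  moreover have "2 \<le> card P" if P: "consecutive_partition as P" for P
  proof (rule ccontr)
    assume less: "\<not> 2 \<le> card P"
    have part: "partition_on {1..n} P" using P as by (simp add: consecutive_partition_def)
    \<comment> \<open>As \<open>card\<close> is 0 on infinite sets, ruling out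
      \<open>card P = 0\<close> takes finiteness besides nonemptiness.\<close>
    then have "finite P" by (rule finite_elements[rotated]) simp
    moreover have un: "\<Union> P = {1..n}" using part by (simp add: partition_on_def)
    then have "P \<noteq> {}" using j by auto
    ultimately have "card P \<noteq> 0" by simp
    then have "card P = 1" using less by linarith
    then obtain B where PB: "P = {B}" by (rule card_1_singletonE)
    then have "B = {1..n}" using un by simp
    then have "sorted (filter (\<lambda>a. a \<in> {1..n}) as)"
      using P PB by (simp add: consecutive_partition_def)
    moreover have "filter (\<lambda>a. a \<in> {1..n}) as = as" using as(2) by (intro filter_True) simp
    ultimately show False using unsorted by simp
  qed
  ultimately show ?thesis
    unfolding standard_consecutive_structure_def using as \<sigma> by metis
qed

section \<open>The cycle at infinity\<close>

text \<open>The order on the line at infinity does not depend on how the sides are directed.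
  Reversing one side flips both its cross product and its \<open>h\<close>, so the factor
  \<open>h i * h k\<close> makes the condition invariant.\<close>

lemma cycle_at_infinity_directions:
  fixes L :: "nat \<Rightarrow> ('a::linordered_field \<times> 'a) set"
  assumes arr: "line_arrangement (L ` {1..n})" and inj: "inj_on L {1..n}"
    and cyc: "is_cycle_at_infinity n L \<sigma>"
    and vw: "\<And>i. i \<in> {1..n} \<Longrightarrow> v i \<in> L i \<and> w i \<in> L i \<and> v i \<noteq> w i"
  obtains xs h where "distinct xs" "set xs = {1..n}" "\<sigma> = cycle_of_list xs"
    "sorted_wrt (\<lambda>i k. cross (w i - v i) (w k - v k) * (h i * h k) > 0) xs"
proof -
  obtain M xs where M: "line_at_infinity (L ` {1..n}) M" and
    xs: "distinct xs" "set xs = {1..n}" "\<sigma> = cycle_of_list xs" and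
    sorted: "sorted_wrt (\<lambda>i j. orient (the_elem (M \<inter> L i)) (the_elem (M \<inter> L j)) (0, 0) > 0) xs"
    using cyc unfolding is_cycle_at_infinity_def by (elim exE conjE) (rule that)
  obtain p q r where pqr: "(p, q) \<noteq> (0, 0)" "r > 0" "M = line p q r"
    and below: "\<forall>(x, y)\<in>crossings (L ` {1..n}). p * x + q * y < r"
    using M unfolding line_at_infinity_def by (elim exE conjE) (rule that)
  have np: "\<not> parallel M (L i)" if "i \<in> {1..n}" for i
    using M that by (simp add: line_at_infinity_def)
  have lineM: "is_line M" using pqr by (auto simp: is_line_def)
  have lines: "is_line (L i)" if "i \<in> {1..n}" for i
    using arr that by (auto simp: line_arrangement_def)
  define h where "h i = cross (w i - v i) (- q, p)" for i
  have pt: "the_elem (M \<inter> L i) \<in> line p q r \<and> the_elem (M \<inter> L i) \<in> L i" if "i \<in> {1..n}" for i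
    using lines_meet_in_point[OF lineM lines[OF that] np[OF that]] pqr(3)
    by (metis Int_iff singletonI the_elem_eq)
  have "sorted_wrt (\<lambda>i k. cross (w i - v i) (w k - v k) * (h i * h k) > 0) xs"
    using sorted
  proof (rule sorted_wrt_mono_rel[rotated])
    fix i k assume "i \<in> set xs" "k \<in> set xs" and
      or: "orient (the_elem (M \<inter> L i)) (the_elem (M \<inter> L k)) (0, 0) > 0"
    then have ik: "i \<in> {1..n}" "k \<in> {1..n}" using xs by auto
    have "i \<noteq> k" using or by (auto simp: orient_def)
    then have Lne: "L i \<noteq> L k" using inj ik by (simp add: inj_on_eq_iff)
    then have "\<not> parallel (L i) (L k)" using arr ik by (auto simp: line_arrangement_def)
    then obtain x where x: "x \<in> L i" "x \<in> L k" by (auto simp: parallel_def)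
    then have "x \<in> crossings (L ` {1..n})"
      using ik Lne unfolding crossings_def crossings_on_def by blast
    then have "p * fst x + q * snd x < r" using below by (simp add: case_prod_beta)
    then show "cross (w i - v i) (w k - v k) * (h i * h k) > 0"
      unfolding h_def
      using cross_of_order_at_infinity[of "L i" "v i" "w i" "L k" "v k" "w k" x p q r]
        lines ik vw x pqr(2) pt or by blast
  qed
  with xs show ?thesis by (rule that)
qed

text \<open>Rotating an order of lines by slope so that a given line \<open>a\<close> comes first amounts to
  orienting all directions into the half-plane to the left of \<open>d a\<close>.\<close>
lemma sorted_by_direction_rotated:
  fixes d :: "'i \<Rightarrow> 'a::linordered_field \<times> 'a"
  assumes sorted: "sorted_wrt (\<lambda>i k. cross (d i) (d k) * (h i * h k) > 0) (xs @ a # ys)"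
  shows "sorted_wrt (\<lambda>i k. cross (d i) (d k) * (cross (d a) (d i) * cross (d a) (d k)) > 0) (ys @ xs)"
proof -
  define R where "R i k \<longleftrightarrow> cross (d i) (d k) * (h i * h k) > 0" for i k
  define S where "S i k \<longleftrightarrow> cross (d i) (d k) * (cross (d a) (d i) * cross (d a) (d k)) > 0" for i k
  have key: "s * (c * c') > 0"
    if "s * (hi * hk) > 0" "(c * (ha * hi)) * (c' * (ha * hk)) > 0" for s c c' ha hi hk :: 'a
  proof -
    have "(s * (hi * hk)) * ((c * (ha * hi)) * (c' * (ha * hk))) > 0" using that by (rule mult_pos_pos)
    also have "(s * (hi * hk)) * ((c * (ha * hi)) * (c' * (ha * hk))) =
        (s * (c * c')) * (hi * hk * ha)\<^sup>2"
      by (simp add: power2_eq_square mult_ac)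
    finally show ?thesis by (meson mult_nonpos_nonneg not_less zero_le_power2)
  qed
  have "sorted_wrt R (xs @ a # ys)" using sorted by (simp add: R_def[abs_def])
  then have xs: "sorted_wrt R xs" and ys: "sorted_wrt R ys" and xa: "\<And>i. i \<in> set xs \<Longrightarrow> R i a"
    and ay: "\<And>i. i \<in> set ys \<Longrightarrow> R a i" and xy: "\<And>i k. i \<in> set xs \<Longrightarrow> k \<in> set ys \<Longrightarrow> R i k"
    by (auto simp: sorted_wrt_append)
  have left: "cross (d a) (d i) * (h a * h i) > 0" if "i \<in> set ys" for i
    using ay[OF that] by (simp only: R_def)
  have right: "cross (d a) (d i) * (h a * h i) < 0" if "i \<in> set xs" for i
    using xa[OF that] cross_anticommute[of "d i" "d a"] by (simp add: R_def mult.commute[of "h i"])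
  have "sorted_wrt S xs" using xs
  proof (rule sorted_wrt_mono_rel[rotated])
    fix i k assume ik: "i \<in> set xs" "k \<in> set xs" "R i k"
    show "S i k" unfolding S_def
      by (rule key[OF ik(3)[unfolded R_def] mult_neg_neg[OF right right]]) (use ik in auto)
  qed
  moreover have "sorted_wrt S ys" using ys
  proof (rule sorted_wrt_mono_rel[rotated])
    fix i k assume ik: "i \<in> set ys" "k \<in> set ys" "R i k"
    show "S i k" unfolding S_def
      by (rule key[OF ik(3)[unfolded R_def] mult_pos_pos[OF left left]]) (use ik in auto)
  qed
  \<comment> \<open>For a pair from different parts the rotation reverses the order, and only
    \<open>k\<close> has a negative sign relative to \<open>a\<close>; the two minus signs
    cancel.\<close>
  moreover have "S i k" if ik: "i \<in> set ys" "k \<in> set xs" for i k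
  proof -
    have "- (cross (d k) (d i) * (h k * h i)) < 0" using xy[OF ik(2,1)] unfolding R_def by simp
    then have "cross (d i) (d k) * (h i * h k) < 0"
      using cross_anticommute[of "d i" "d k"] by (simp only: mult.commute[of "h i"] mult_minus_left)
    then have "- cross (d i) (d k) * (h i * h k) > 0" by (simp only: mult_minus_left neg_0_less_iff_less)
    moreover have "- (cross (d a) (d k) * (h a * h k)) > 0" using right[OF ik(2)] by simp
    then have "(cross (d a) (d i) * (h a * h i)) * (- cross (d a) (d k) * (h a * h k)) > 0"
      using mult_pos_pos[OF left[OF ik(1)]] by (simp only: mult_minus_left)
    ultimately have "- cross (d i) (d k) * (cross (d a) (d i) * - cross (d a) (d k)) > 0"
      by (rule key)
    then show ?thesis by (simp only: S_def mult_minus_left mult_minus_right minus_minus)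
  qed
  ultimately have "sorted_wrt S (ys @ xs)" by (simp add: sorted_wrt_append)
  then show ?thesis by (simp add: S_def[abs_def])
qed

theorem theorem5p2:
  fixes n :: nat and L :: "nat \<Rightarrow> ('a::linordered_field \<times> 'a) set" and \<sigma> :: "nat \<Rightarrow> nat"
  assumes "n \<ge> 3"
    and "inj_on L {1..n}"
    and "line_arrangement (L ` {1..n})"
    and "gonality n L"
    and "is_cycle_at_infinity n L \<sigma>"
  shows "standard_consecutive_structure n \<sigma> 2"
proof -
  obtain v w j where
    vw: "\<And>i. i \<in> {1..n} \<Longrightarrow> v i \<in> L i \<and> w i \<in> L i \<and> v i \<noteq> w i" and
    j: "2 \<le> j" "j < n" and
    up': "\<And>i. 2 \<le> i \<Longrightarrow> i \<le> j \<Longrightarrow> cross (w 1 - v 1) (w i - v i) > 0" and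
    down': "\<And>i. j < i \<Longrightarrow> i \<le> n \<Longrightarrow> cross (w 1 - v 1) (w i - v i) < 0" and
    next_pos': "\<And>i. 1 \<le> i \<Longrightarrow> i < n \<Longrightarrow> cross (w i - v i) (w (Suc i) - v (Suc i)) > 0"
    by (rule gonality_directions[OF assms(1-4)]) (rule that)
  obtain xs h where xs: "distinct xs" "set xs = {1..n}" "\<sigma> = cycle_of_list xs"
    and by_h: "sorted_wrt (\<lambda>i k. cross (w i - v i) (w k - v k) * (h i * h k) > 0) xs"
    by (rule cycle_at_infinity_directions[OF assms(3,2,5) vw]) (assumption, rule that)
  have "1 \<in> set xs" using xs assms(1) by simp
  then obtain ys zs where split: "xs = ys @ 1 # zs" by (meson split_list)
  define d where "d i = w i - v i" for i
  have up: "cross (d 1) (d i) > 0" if "2 \<le> i" "i \<le> j" for i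
    unfolding d_def by (rule up'[OF that])
  have down: "cross (d 1) (d i) < 0" if "j < i" "i \<le> n" for i
    unfolding d_def by (rule down'[OF that])
  have next_pos: "cross (d i) (d (Suc i)) > 0" if "1 \<le> i" "i < n" for i
    unfolding d_def by (rule next_pos'[OF that])
  define S where "S i k \<longleftrightarrow> cross (d i) (d k) * (cross (d 1) (d i) * cross (d 1) (d k)) > 0" for i k
  have "sorted_wrt (\<lambda>i k. cross (d i) (d k) * (h i * h k) > 0) (ys @ 1 # zs)"
    using by_h unfolding split d_def .
  then have sorted: "sorted_wrt S (zs @ ys)"
    unfolding S_def[abs_def] by (rule sorted_by_direction_rotated)
  define as where "as = 1 # zs @ ys"
  have "rotate (length ys) xs = as" by (simp add: split rotate_append as_def)
  then have \<sigma>: "\<sigma> = cycle_of_list as"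
    using cycle_of_list_rotate_independent[OF xs(1), of "length ys"] xs(3) by simp
  have as: "distinct as" "set as = {1..n}" using xs by (auto simp: split as_def)
  have rest: "2 \<le> i \<and> i \<le> n" if "i \<in> set (zs @ ys)" for i
  proof -
    have "i \<noteq> 1" using as(1) that by (auto simp: as_def)
    moreover have "i \<in> {1..n}" using as(2) that by (auto simp: as_def)
    ultimately show ?thesis by auto
  qed
  \<comment> \<open>Within a block all directions lie on the same side of \<open>d 1\<close>, so the
    Pluecker relation chains the positive turns between successive sides.\<close>
  have same_block: "cross (d i) (d k) > 0"
    if i: "2 \<le> i" "i < k" and k: "k \<le> n" and block: "k \<le> j \<or> j < i" for i k
  proof -
    have "Suc i \<le> k" using i by simp
    then show ?thesis using k block
    proof (induction k rule: dec_induct)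
      case base
      show ?case by (rule next_pos) (use i k in auto)
    next
      case (step k)
      have ik: "2 \<le> i" "i < k" "2 \<le> k" "Suc k \<le> n" and block: "Suc k \<le> j \<or> j < i"
        using step.hyps step.prems i by linarith+
      have IH: "cross (d i) (d k) > 0" by (rule step.IH) (use ik block in linarith)+
      have nx: "cross (d k) (d (Suc k)) > 0" by (rule next_pos) (use ik in auto)
      have eq: "cross (d 1) (d k) * cross (d i) (d (Suc k)) =
          cross (d 1) (d i) * cross (d k) (d (Suc k)) + cross (d 1) (d (Suc k)) * cross (d i) (d k)"
        by (rule cross_pluecker)
      from block show ?case
      proof
        assume "Suc k \<le> j"
        with ik have c: "cross (d 1) (d k) > 0" "cross (d 1) (d i) > 0" "cross (d 1) (d (Suc k)) > 0"
          by (intro up; linarith)+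
        have "cross (d 1) (d k) * cross (d i) (d (Suc k)) > 0"
          unfolding eq by (rule add_pos_pos[OF mult_pos_pos[OF c(2) nx] mult_pos_pos[OF c(3) IH]])
        then show ?thesis using c(1) by (simp only: zero_less_mult_pos)
      next
        assume "j < i"
        with ik have c: "cross (d 1) (d k) < 0" "cross (d 1) (d i) < 0" "cross (d 1) (d (Suc k)) < 0"
          by (intro down; linarith)+
        have "cross (d 1) (d k) * cross (d i) (d (Suc k)) < 0"
          unfolding eq by (rule add_neg_neg[OF mult_neg_pos[OF c(2) nx] mult_neg_pos[OF c(3) IH]])
        then show ?thesis using c(1) by (simp add: mult_less_0_iff)
      qed
    qed
  qed
  \<comment> \<open>Inside a block the two pairings with \<open>d 1\<close> have the same sign, so
    \<open>S i k\<close> reduces to \<open>cross (d i) (d k) > 0\<close>.\<close>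
  have S_less: "i < k" if ik: "2 \<le> i" "i \<le> n" "2 \<le> k" "k \<le> n" "S i k" and
    block: "i \<le> j \<longleftrightarrow> k \<le> j" for i k
  proof (rule ccontr)
    assume "\<not> i < k"
    moreover have "i \<noteq> k" using ik by (auto simp: S_def)
    ultimately have "k < i" by simp
    then have "cross (d k) (d i) > 0" using same_block[of k i] ik block by linarith
    moreover have "cross (d 1) (d i) * cross (d 1) (d k) > 0"
    proof (cases "i \<le> j")
      case True
      then show ?thesis using ik block by (intro mult_pos_pos up) auto
    next
      case False
      then show ?thesis using ik block by (intro mult_neg_neg down) auto
    qed
    ultimately have "cross (d k) (d i) * (cross (d 1) (d i) * cross (d 1) (d k)) > 0"
      by (rule mult_pos_pos)
    then have "cross (d i) (d k) * (cross (d 1) (d i) * cross (d 1) (d k)) < 0"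
      unfolding cross_anticommute[of "d i" "d k"] by simp
    then show False using ik(5) unfolding S_def by (rule less_asym)
  qed
  have sorted_block: "sorted (filter Q as)"
    if Q: "\<And>i k. Q i \<Longrightarrow> Q k \<Longrightarrow> i \<le> j \<longleftrightarrow> k \<le> j" for Q
  proof -
    have "sorted (filter Q (zs @ ys))"
      using sorted_wrt_filter[OF sorted]
    proof (rule sorted_wrt_mono_rel[rotated])
      fix i k assume "i \<in> set (filter Q (zs @ ys))" "k \<in> set (filter Q (zs @ ys))" and S: "S i k"
      then have "i \<in> set (zs @ ys)" "k \<in> set (zs @ ys)" "Q i" "Q k" by auto
      then have "i < k" using rest[of i] rest[of k] by (intro S_less[OF _ _ _ _ S Q]) blast+
      then show "i \<le> k" by simp
    qed
    \<comment> \<open>The head 1 is compared numerically: \<open>S 1 k\<close> is always false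
      because \<open>cross (d 1) (d 1)\<close> is 0.\<close>
    moreover have "1 \<le> i" if "i \<in> set (filter Q (zs @ ys))" for i
      using as(2) that by (auto simp: as_def)
    ultimately show ?thesis by (simp add: as_def)
  qed
  have "\<not> sorted as"
  proof
    assume "sorted as"
    then have inc: "sorted (zs @ ys)" by (simp add: as_def)
    have "j \<in> set as" "Suc j \<in> set as" using as(2) j by simp_all
    then have "j \<in> set (zs @ ys)" "Suc j \<in> set (zs @ ys)" using j by (simp_all add: as_def)
    then obtain a b where ab: "a < length (zs @ ys)" "b < length (zs @ ys)"
      "(zs @ ys) ! a = j" "(zs @ ys) ! b = Suc j" by (metis in_set_conv_nth)
    have "a < b"
    proof (rule ccontr)
      assume "\<not> a < b"
      then have "(zs @ ys) ! b \<le> (zs @ ys) ! a" using inc ab by (intro sorted_nth_mono) auto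
      then show False using ab by simp
    qed
    then have "S j (Suc j)" using sorted ab by (metis sorted_wrt_nth_less)
    \<comment> \<open>At the cut the turn is still positive, but \<open>d j\<close> and
      \<open>d (Suc j)\<close> lie on opposite sides of \<open>d 1\<close>.\<close>
    moreover have "cross (d j) (d (Suc j)) * (cross (d 1) (d j) * cross (d 1) (d (Suc j))) < 0"
      by (intro mult_pos_neg next_pos up down) (use j in auto)
    ultimately show False unfolding S_def by (rule less_asym)
  qed
  show ?thesis
  proof (rule standard_consecutive_structure_2I[OF as _ \<sigma>])
    show "hd as = 1" by (simp add: as_def)
    show "1 \<le> j" "j < n" using j by simp_all
    show "sorted (filter (\<lambda>a. a \<le> j) as)" by (rule sorted_block) simp
    show "sorted (filter (\<lambda>a. j < a) as)" by (rule sorted_block) simp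
  qed fact
qed

end
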